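(* Let $\Omega\subset\mathbb{R}^2$ be a bounded open set with Lipschitz boundary, and let $\gamma$ be a minimal curve for $\Omega$. Then every self-contact point of $\gamma$ has multiplicity not greater than $2$, i.e. every self-intersection is associated with a unique self-contact couple. In addition, if $\gamma$ admits at least two self-intersections, then there exist four ordered times $t<s<\tau<\sigma$ in $\mathbb{S}^1$ such that: \begin{itemize} \item $(t,s)$ and $(\tau,\sigma)$ are self-contact couples; \item $\gamma_{|]t,s[}$ and $\gamma_{|]\tau,\sigma[}$ are pieces of curve without contact points, i.e. $]t,s[\,\cap\,\mathcal{C}=\emptyset$ and $]\tau,\sigma[\,\cap\,\mathcal{C}=\emptyset$ (they possibly have contact with $\partial\Omega$); \item $\gamma_{|]s,\tau[}$ and $\gamma_{|]\sigma,t[}$ are curves without self-contact (each taken individually) and with the same energy. They possibly have tangent contact with each other, and in that case, for all $a\in\,]s,\tau[$ and all $b\in\,]\sigma,t[$ such that $\gamma(a)=\gamma(b)$, we have \[ \mathcal{W}(\gamma_{|[s,a]})=\mathcal{W}(\gamma_{|[b,t]})\quad\text{and}\quad \mathcal{W}(\gamma_{|[a,\tau]})=\mathcal{W}(\gamma_{|[\sigma,b]}). \] \end{itemize}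
   Context: $\mathbb{S}^1$ is the circle. A regular curve is a closed curve $\gamma:\mathbb{S}^1\to\mathbb{R}^2$ with $\gamma,\gamma',\gamma''\in L^2(\mathbb{S}^1,\mathbb{R}^2)$ (so $\gamma\in C^1$) and $|\gamma'(t)|>0$ for all $t$. Writing $\gamma:[0,L]\to\mathbb{R}^2$ for its arc-length parametrization, the bending energy is $\mathcal{W}(\gamma)=\int_0^L|\gamma''(s)|^2\,ds$; for a sub-arc of $\gamma$, $\mathcal{W}$ denotes the integral of $\kappa^2$ ($\kappa$ the curvature) with respect to arc length over that sub-arc. The set $\mathcal{A}$ of admissible curves is the set of regular closed curves whose image $(\gamma)$ is contained in $\overline\Omega$ and all of whose self-intersections (if any) are tangential: if $\gamma(t)=\gamma(s)$ with $t\ne s$, then $\gamma'(t)$ and $\gamma'(s)$ are parallel (same or opposite directions). A minimal curve is a $\gamma\in\mathcal{A}$ with $\mathcal{W}(\gamma)=\min_{\tilde\gamma\in\mathcal{A}}\mathcal{W}(\tilde\gamma)$. Curves are parametrized with constant speed on $\mathbb{S}^1$. The set of self-intersections is $\mathcal{C}=\{t\in\mathbb{S}^1 : \exists s\in\mathbb{S}^1,\ s\ne t,\ \gamma(t)=\gamma(s)\}$. Fix an orientation of $\mathbb{S}^1$. Times are called ordered, written $t_1<t_2<t_3<\dots$, if they are met in this cyclic order (i.e. the inequalities hold up to a circular permutation). For two times $p,q$, $]p,q[$ is the open arc of $\mathbb{S}^1$ going from $p$ to $q$ in the positive orientation, $[p,q]$ its closure, and $\gamma_{|]p,q[}$, $\gamma_{|[p,q]}$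 the corresponding restrictions of $\gamma$ (so for $t<s<\tau<\sigma$, the arc $]\sigma,t[$ contains neither $s$ nor $\tau$). A pair $(t,s)$ of distinct times is a self-contact couple if $\gamma(t)=\gamma(s)$. The multiplicity of a point $x\in(\gamma)$ is the number of $t\in\mathbb{S}^1$ with $\gamma(t)=x$. *)

theory Defs
  imports "HOL-Analysis.Analysis"
begin

text \<open>
  The circle is the quotient of the real line by the integers, oriented by increasing parameter.
  A map on the circle is a 1-periodic function on the reals, and two reals name the same time iff
  their difference is an integer. Four times of the circle in cyclic order are represented by reals
  \<open>t < s < \<tau> < \<sigma> < t + 1\<close>; the open arc from \<open>\<sigma>\<close> to \<open>t\<close> is then \<open>{\<sigma><..<t + 1}\<close>.
\<close>

type_synonym curve = "real \<Rightarrow> real ^ 2"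

definition velocity :: "curve \<Rightarrow> curve" where
  "velocity \<gamma> t = vector_derivative \<gamma> (at t)"

text \<open>The value is meaningful only where the velocity is differentiable, which for the curves
  considered below is almost everywhere.\<close>

definition acceleration :: "curve \<Rightarrow> curve" where
  "acceleration \<gamma> t = vector_derivative (velocity \<gamma>) (at t)"

text \<open>
  Closed curves of Sobolev class \<open>H\<^sup>2\<close> with nonvanishing velocity. In one dimension \<open>H\<^sup>2\<close> consists of
  the \<open>C\<^sup>1\<close> maps whose derivative is absolutely continuous with square integrable derivative. Absolute
  continuity of the velocity is expressed by its being differentiable almost everywhere and an
  indefinite integral of its derivative; this makes it continuous, so that the curve and its
  velocity are square integrable on a period.
\<close>

definition regular_closed_curve :: "curve \<Rightarrow> bool" where
  "regular_closed_curve \<gamma> \<longleftrightarrow>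
     (\<forall>t. \<gamma> (t + 1) = \<gamma> t) \<and>
     (\<forall>t. \<gamma> differentiable (at t)) \<and>
     (AE t in lebesgue. velocity \<gamma> differentiable (at t)) \<and>
     (\<forall>a b. a \<le> b \<longrightarrow> (acceleration \<gamma> has_integral (velocity \<gamma> b - velocity \<gamma> a)) {a..b}) \<and>
     (\<lambda>t. (norm (acceleration \<gamma> t))\<^sup>2) absolutely_integrable_on {0..1} \<and>
     (\<forall>t. norm (velocity \<gamma> t) > 0)"

definition constant_speed :: "curve \<Rightarrow> bool" where
  "constant_speed \<gamma> \<longleftrightarrow> (\<exists>c. \<forall>t. norm (velocity \<gamma> t) = c)"

definition curvature :: "curve \<Rightarrow> real \<Rightarrow> real" where
  "curvature \<gamma> t =
     (velocity \<gamma> t $ 1 * acceleration \<gamma> t $ 2 - velocity \<gamma> t $ 2 * acceleration \<gamma> t $ 1)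
       / norm (velocity \<gamma> t) ^ 3"

text \<open>
  Integral of the squared curvature with respect to arc length \<open>|\<gamma>'(t)| dt\<close> over the sub-arc with
  parameters from \<open>a\<close> to \<open>b\<close>. In the arc-length parametrization the integrand is \<open>|\<gamma>''|\<^sup>2\<close>, the
  acceleration being orthogonal to the unit velocity.
\<close>

definition arc_energy :: "curve \<Rightarrow> real \<Rightarrow> real \<Rightarrow> real" where
  "arc_energy \<gamma> a b = integral {a..b} (\<lambda>t. (curvature \<gamma> t)\<^sup>2 * norm (velocity \<gamma> t))"

definition bending_energy :: "curve \<Rightarrow> real" where
  "bending_energy \<gamma> = arc_energy \<gamma> 0 1"

definition self_contact_couple :: "curve \<Rightarrow> real \<Rightarrow> real \<Rightarrow> bool" where
  "self_contact_couple \<gamma> t s \<longleftrightarrow> t - s \<notin> \<int> \<and> \<gamma> t = \<gamma> s"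

definition contact_set :: "curve \<Rightarrow> real set" where
  "contact_set \<gamma> = {t. \<exists>s. self_contact_couple \<gamma> t s}"

text \<open>The half-open unit interval contains exactly one representative of each time of the circle.\<close>

definition times_at :: "curve \<Rightarrow> real ^ 2 \<Rightarrow> real set" where
  "times_at \<gamma> x = {t \<in> {0..<1}. \<gamma> t = x}"

text \<open>In the last clause \<open>c\<close> may have either sign.\<close>

definition admissible :: "(real ^ 2) set \<Rightarrow> curve \<Rightarrow> bool" where
  "admissible \<Omega> \<gamma> \<longleftrightarrow>
     regular_closed_curve \<gamma> \<and> range \<gamma> \<subseteq> closure \<Omega> \<and>
     (\<forall>t s. self_contact_couple \<gamma> t s \<longrightarrow> (\<exists>c. velocity \<gamma> t = c *\<^sub>R velocity \<gamma> s))"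

definition minimal_curve :: "(real ^ 2) set \<Rightarrow> curve \<Rightarrow> bool" where
  "minimal_curve \<Omega> \<gamma> \<longleftrightarrow>
     admissible \<Omega> \<gamma> \<and> (\<forall>\<gamma>'. admissible \<Omega> \<gamma>' \<longrightarrow> bending_energy \<gamma> \<le> bending_energy \<gamma>')"

text \<open>Near each boundary point, and in suitable orthonormal coordinates \<open>(y \<bullet> u, y \<bullet> v)\<close>, the set is
  the part of the plane strictly below the graph of a Lipschitz function.\<close>

definition lipschitz_boundary :: "(real ^ 2) set \<Rightarrow> bool" where
  "lipschitz_boundary \<Omega> \<longleftrightarrow>
     (\<forall>p \<in> frontier \<Omega>. \<exists>r > 0. \<exists>u v :: real ^ 2. \<exists>(g :: real \<Rightarrow> real) K.
        norm u = 1 \<and> norm v = 1 \<and> u \<bullet> v = 0 \<and> lipschitz_on K UNIV g \<and>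
        (\<forall>y \<in> ball p r. y \<in> \<Omega> \<longleftrightarrow> y \<bullet> v < g (y \<bullet> u)))"

end

theory Submission
  imports Defs
begin

text \<open>
  Every argument is a comparison with a closed curve obtained by cutting the minimiser at
  self-contacts and reassembling some of its arcs, possibly reversed. Such a curve is again of class
  \<open>H\<^sup>2\<close> as soon as velocities match at the seams, stays in the closure of the domain, and meets
  itself only where the minimiser is already present with parallel velocity, hence tangentially
  (\<open>energy_le_closed_arc\<close>). Its energy is the sum of the energies of its arcs. Two assemblies
  suffice: a single arc that closes up (\<open>energy_le_loop\<close>), and one arc followed by another one
  reversed (\<open>energy_le_loop_with_reversal\<close>). Let \<open>W > 0\<close> be the minimal energy.

  At a self-contact the two velocities are opposite: if they were equal, the curve would split into
  two closed curves of total energy \<open>W\<close>, each of energy at least \<open>W\<close>. As at most two of several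
  parallel velocities of the same norm are pairwise opposite, no point has multiplicity three
  (\<open>contact_unique\<close>). Reversing one arc of a couple turns an interlaced couple into a contact with
  equal velocities, so couples do not interlace (\<open>contact_no_crossing\<close>).

  Now let \<open>t < s < \<tau> < \<sigma> < t + 1\<close> with couples \<open>(t, s)\<close> and \<open>(\<tau>, \<sigma>)\<close>. Replacing the arc from
  \<open>\<sigma>\<close> to \<open>t + 1\<close> by the reversed arc from \<open>s\<close> to \<open>\<tau>\<close>, or conversely, gives competitors, so both
  arcs have the same energy (\<open>energy_between_contacts\<close>) and the competitors are minimal as well.
  A self-contact of either arc would then be a quadruple point of a minimal curve, which is
  excluded (\<open>no_contact_between_contacts\<close>). The same equality applied to \<open>(t, s)\<close> with a contact
  \<open>(a, b)\<close> between the two arcs, and to \<open>(a, b)\<close> with \<open>(\<tau>, \<sigma>)\<close>, gives the energies of the partial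
  arcs. Finally, compactness and the absence of interlacing provide an innermost couple inside each
  of two disjoint ones (\<open>innermost_contact\<close>, \<open>disjoint_contacts\<close>), whose loops are free of contacts.
\<close>

section \<open>Arcs of Sobolev class \<open>H\<^sup>2\<close>\<close>

text \<open>
  Derivative, second derivative and curve are carried as separate functions because an arc cut out
  of a curve and traversed in either direction comes with explicit formulas for all three. Two-sided
  differentiability of the velocity is asked for almost everywhere in the open interval only, so that
  arcs can be glued at an endpoint where the velocity has a corner. The fields are exactly what is
  needed to recover an \<open>H\<^sup>2\<close> closed curve, whose definition demands both that the velocity be
  differentiable almost everywhere and that it be the integral of its derivative.
\<close>

definition h2_arc :: "real \<Rightarrow> real \<Rightarrow> curve \<Rightarrow> curve \<Rightarrow> curve \<Rightarrow> bool" where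
  "h2_arc a b f v w \<longleftrightarrow>
     (\<forall>t \<in> {a..b}. (f has_vector_derivative v t) (at t within {a..b})) \<and>
     (\<forall>x y. a \<le> x \<longrightarrow> x \<le> y \<longrightarrow> y \<le> b \<longrightarrow> (w has_integral (v y - v x)) {x..y}) \<and>
     (\<exists>N. negligible N \<and> (\<forall>t \<in> {a<..<b} - N. (v has_vector_derivative w t) (at t))) \<and>
     (\<lambda>t. (norm (w t))\<^sup>2) integrable_on {a..b}"

lemma h2_arc_subset:
  assumes "h2_arc a b f v w" "a \<le> c" "d \<le> b"
  shows "h2_arc c d f v w"
proof -
  have sub: "{c..d} \<subseteq> {a..b}" using assms by auto
  obtain N where N: "negligible N" "\<forall>t \<in> {a<..<b} - N. (v has_vector_derivative w t) (at t)"
    using assms unfolding h2_arc_def by blast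
  have "\<forall>t \<in> {c<..<d} - N. (v has_vector_derivative w t) (at t)"
    using N assms by auto
  moreover have "(\<lambda>t. (norm (w t))\<^sup>2) integrable_on {c..d}"
    using assms sub unfolding h2_arc_def by (blast intro: integrable_on_subinterval)
  moreover have "\<forall>t \<in> {c..d}. (f has_vector_derivative v t) (at t within {c..d})"
    using assms sub unfolding h2_arc_def
    by (meson has_vector_derivative_within_subset subsetD)
  moreover have "\<forall>x y. c \<le> x \<longrightarrow> x \<le> y \<longrightarrow> y \<le> d \<longrightarrow> (w has_integral (v y - v x)) {x..y}"
    using assms unfolding h2_arc_def by auto
  ultimately show ?thesis using N(1) unfolding h2_arc_def by blast
qed

text \<open>
  The second derivative may be changed at the endpoints, where a piecewise formula chooses the
  value of one neighbour.
\<close>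

lemma h2_arc_cong:
  assumes "h2_arc a b f v w"
    and "\<And>t. t \<in> {a..b} \<Longrightarrow> f' t = f t" "\<And>t. t \<in> {a..b} \<Longrightarrow> v' t = v t"
    and "\<And>t. t \<in> {a<..<b} \<Longrightarrow> w' t = w t"
  shows "h2_arc a b f' v' w'"
proof -
  obtain N where N: "negligible N" "\<forall>t \<in> {a<..<b} - N. (v has_vector_derivative w t) (at t)"
    using assms(1) unfolding h2_arc_def by blast
  have "(f' has_vector_derivative v' t) (at t within {a..b})" if "t \<in> {a..b}" for t
    using assms that unfolding h2_arc_def
    by (metis has_vector_derivative_transform)
  moreover have "(w' has_integral (v' y - v' x)) {x..y}" if "a \<le> x" "x \<le> y" "y \<le> b" for x y
  proof -
    have i: "(w has_integral (v y - v x)) {x..y}" using assms(1) that unfolding h2_arc_def by blast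
    have "(w' has_integral (v y - v x)) {x..y}"
      by (rule has_integral_spike[of "{a,b}", OF _ _ i]) (use assms(4) that in auto)
    then show ?thesis using assms(3) that by simp
  qed
  moreover have "(v' has_vector_derivative w' t) (at t)" if t: "t \<in> {a<..<b} - N" for t
  proof -
    have "(v has_vector_derivative w' t) (at t)" using N(2) t assms(4) by simp
    then show ?thesis
      by (rule has_vector_derivative_transform_within_open[of v _ t "{a<..<b}"])
         (use assms(3) t in auto)
  qed
  moreover have "(\<lambda>t. (norm (w' t))\<^sup>2) integrable_on {a..b}"
  proof (rule integrable_spike[of "\<lambda>t. (norm (w t))\<^sup>2" _ "{a,b}"])
    show "(\<lambda>t. (norm (w t))\<^sup>2) integrable_on {a..b}" using assms(1) unfolding h2_arc_def by blast
  qed (use assms(4) in auto)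
  ultimately show ?thesis using N(1) unfolding h2_arc_def by blast
qed

text \<open>
  Agreement of \<open>f\<close> and \<open>v\<close> at the common endpoint is implicit, the same functions serving on both
  sides. A jump of \<open>w\<close> there is harmless: this is the point of working in \<open>H\<^sup>2\<close> rather than \<open>C\<^sup>2\<close>.
\<close>

lemma h2_arc_join:
  assumes 1: "h2_arc a b f v w" and 2: "h2_arc b c f v w" and "a \<le> b" "b \<le> c"
  shows "h2_arc a c f v w"
proof -
  obtain N where N: "negligible N" "\<forall>t \<in> {a<..<b} - N. (v has_vector_derivative w t) (at t)"
    using 1 unfolding h2_arc_def by blast
  obtain M where M: "negligible M" "\<forall>t \<in> {b<..<c} - M. (v has_vector_derivative w t) (at t)"
    using 2 unfolding h2_arc_def by blast
  have un: "{a..c} = {a..b} \<union> {b..c}" using assms by auto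
  have "(f has_vector_derivative v t) (at t within {a..c})" if t: "t \<in> {a..c}" for t
  proof -
    have "(f has_vector_derivative v t) (at t within {a..b})"
    proof (cases "t \<le> b")
      case False
      then have "at t within {a..b} = at t within {}"
        by (intro at_within_nhd[of t "{b<..}"]) auto
      then show ?thesis by (simp add: has_vector_derivative_def has_derivative_def)
          (auto intro: bounded_linear_intros)
    qed (use 1 t in \<open>auto simp: h2_arc_def\<close>)
    moreover have "(f has_vector_derivative v t) (at t within {b..c})"
    proof (cases "b \<le> t")
      case False
      then have "at t within {b..c} = at t within {}"
        by (intro at_within_nhd[of t "{..<b}"]) auto
      then show ?thesis by (simp add: has_vector_derivative_def has_derivative_def)
          (auto intro: bounded_linear_intros)
    qed (use 2 t in \<open>auto simp: h2_arc_def\<close>)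
    ultimately show ?thesis unfolding un has_vector_derivative_def has_derivative_within
      by (simp add: Lim_within_Un)
  qed
  moreover have "(w has_integral (v y - v x)) {x..y}" if "a \<le> x" "x \<le> y" "y \<le> c" for x y
  proof -
    consider "y \<le> b" | "b \<le> x" | "x \<le> b" "b \<le> y" by linarith
    then show ?thesis
    proof cases
      case 3
      have "(w has_integral (v b - v x)) {x..b}" "(w has_integral (v y - v b)) {b..y}"
        using 1 2 3 that unfolding h2_arc_def by auto
      from has_integral_combine[OF 3 this] show ?thesis by simp
    qed (use 1 2 that in \<open>auto simp: h2_arc_def\<close>)
  qed
  moreover have "(v has_vector_derivative w t) (at t)" if "t \<in> {a<..<c} - (N \<union> M \<union> {b})" for t
    using that N M by (cases "t < b") auto
  moreover have "negligible (N \<union> M \<union> {b})" using N M by simp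
  moreover have "(\<lambda>t. (norm (w t))\<^sup>2) integrable_on {a..c}"
    by (rule Henstock_Kurzweil_Integration.integrable_combine[OF assms(3,4)])
      (use 1 2 in \<open>auto simp: h2_arc_def\<close>)
  ultimately show ?thesis unfolding h2_arc_def by blast
qed

lemma affine_image_interval:
  fixes m :: real
  assumes "m \<noteq> 0" "x \<le> y"
  shows "(\<lambda>x. m * x + k) ` {x..y} = {min (m*x+k) (m*y+k)..max (m*x+k) (m*y+k)}"
proof (cases "m > 0")
  case True
  then have "m * x \<le> m * y" using assms by simp
  then show ?thesis using True assms by (auto simp: image_affinity_atLeastAtMost)
next
  case False
  then have "m < 0" "m * y \<le> m * x" using assms by (auto simp: mult_left_mono_neg)
  then show ?thesis using assms by (auto simp: image_affinity_atLeastAtMost)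
qed

text \<open>
  Both signs of \<open>m\<close> are covered: a negative \<open>m\<close> reverses the orientation, and the integral over the
  image interval does not see it.
\<close>

lemma has_integral_affine_real:
  fixes h :: "real \<Rightarrow> 'a::banach"
  assumes "(h has_integral i) ((\<lambda>x. m * x + k) ` {x..y})" and "m \<noteq> 0" "x \<le> y"
  shows "((\<lambda>x. h (m * x + k)) has_integral (i /\<^sub>R \<bar>m\<bar>)) {x..y}"
proof -
  obtain c d where cd: "(\<lambda>x. m * x + k) ` {x..y} = cbox c d"
    using affine_image_interval[OF assms(2,3)] by auto
  have "((\<lambda>x. h (m *\<^sub>R x + k)) has_integral (1 / (\<bar>m\<bar> ^ DIM(real))) *\<^sub>R i)
      ((\<lambda>x. (1 / m) *\<^sub>R x + -((1 / m) *\<^sub>R k)) ` cbox c d)"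
    using assms(1) unfolding cd by (rule has_integral_affinity) fact
  moreover have "(\<lambda>x. (1 / m) *\<^sub>R x + -((1 / m) *\<^sub>R k)) ` cbox c d = {x..y}"
    unfolding cd[symmetric] image_image using assms(2) by (simp add: field_simps)
  ultimately show ?thesis by (simp add: divide_inverse)
qed

lemma h2_arc_affine:
  assumes arc: "h2_arc a b f v w" and m: "m \<noteq> 0"
    and into: "\<And>x. x \<in> {c..d} \<Longrightarrow> m * x + k \<in> {a..b}"
  shows "h2_arc c d (\<lambda>x. f (m * x + k)) (\<lambda>x. m *\<^sub>R v (m * x + k)) (\<lambda>x. m\<^sup>2 *\<^sub>R w (m * x + k))"
proof -
  let ?g = "\<lambda>x. m * x + k"
  obtain N where N: "negligible N" "\<forall>t \<in> {a<..<b} - N. (v has_vector_derivative w t) (at t)"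
    using arc unfolding h2_arc_def by blast
  have g: "(?g has_vector_derivative m) (at x within S)" for x S
    by (auto intro!: derivative_eq_intros)
  have "((\<lambda>x. f (m * x + k)) has_vector_derivative m *\<^sub>R v (m * x + k)) (at x within {c..d})"
    if "x \<in> {c..d}" for x
  proof -
    have "(f has_vector_derivative v (?g x)) (at (?g x) within ?g ` {c..d})"
      using arc into that unfolding h2_arc_def
      by (meson has_vector_derivative_within_subset image_subsetI)
    from vector_diff_chain_within[OF g this] show ?thesis by (simp add: o_def)
  qed
  moreover have "((\<lambda>x. m\<^sup>2 *\<^sub>R w (?g x)) has_integral (m *\<^sub>R v (?g y) - m *\<^sub>R v (?g x))) {x..y}"
    if xy: "c \<le> x" "x \<le> y" "y \<le> d" for x y
  proof -
    have r: "?g x \<in> {a..b}" "?g y \<in> {a..b}" using into xy by auto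
    define i where "i = v (max (?g x) (?g y)) - v (min (?g x) (?g y))"
    have "(w has_integral i) (?g ` {x..y})"
      using arc r unfolding h2_arc_def affine_image_interval[OF m xy(2)] i_def by auto
    from has_integral_cmul[OF has_integral_affine_real[OF this m xy(2)], of "m\<^sup>2"]
    have "((\<lambda>x. m\<^sup>2 *\<^sub>R w (?g x)) has_integral (\<bar>m\<bar> *\<^sub>R i)) {x..y}"
      using m by (simp add: field_simps power2_eq_square abs_if split: if_splits)
    moreover have "\<bar>m\<bar> *\<^sub>R i = m *\<^sub>R v (?g y) - m *\<^sub>R v (?g x)"
    proof (cases "m > 0")
      case True
      then have "m * x \<le> m * y" using xy by simp
      then show ?thesis using True by (simp add: i_def max_def min_def scaleR_diff_right)
    next
      case False
      then have "m * y \<le> m * x" using xy m by (auto simp: mult_left_mono_neg)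
      then show ?thesis using False m
        by (cases "m * x = m * y") (auto simp: i_def max_def min_def scaleR_diff_right)
    qed
    ultimately show ?thesis by simp
  qed
  moreover have "negligible ((\<lambda>x. (x - k) / m) ` N)"
    by (rule negligible_differentiable_image_negligible[OF _ N(1)])
       (auto simp: differentiable_on_def divide_inverse intro!: derivative_intros)
  moreover have "((\<lambda>x. m *\<^sub>R v (?g x)) has_vector_derivative m\<^sup>2 *\<^sub>R w (?g x)) (at x)"
    if x: "x \<in> {c<..<d} - (\<lambda>x. (x - k) / m) ` N" for x
  proof -
    have "?g x \<notin> N"
    proof
      assume "?g x \<in> N"
      then have "(?g x - k) / m \<in> (\<lambda>x. (x - k) / m) ` N" by blast
      then show False using x m by simp
    qed
    moreover have "?g x \<in> {a<..<b}"
    proof -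
      have "c \<le> d" "m * c \<noteq> m * x" "m * d \<noteq> m * x" using x m by auto
      moreover have "min (?g c) (?g d) \<le> ?g x" "?g x \<le> max (?g c) (?g d)"
        using affine_image_interval[OF m \<open>c \<le> d\<close>, of k] x by (auto simp: set_eq_iff image_iff)
          (smt (verit) x greaterThanLessThan_iff DiffD1 atLeastAtMost_iff)+
      ultimately show ?thesis using into[of c] into[of d]
        by (smt (verit) atLeastAtMost_iff greaterThanLessThan_iff)
    qed
    ultimately have "(v has_vector_derivative w (?g x)) (at (?g x))" using N by auto
    then have "(v has_vector_derivative w (?g x)) (at (?g x) within range ?g)"
      using has_vector_derivative_at_within by blast
    from vector_diff_chain_within[OF g this]
    have "((\<lambda>x. v (?g x)) has_vector_derivative m *\<^sub>R w (?g x)) (at x)" by (simp add: o_def)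
    from has_vector_derivative_scaleR[OF DERIV_const this, of m]
    show ?thesis by (simp add: power2_eq_square)
  qed
  moreover have "(\<lambda>x. (norm (m\<^sup>2 *\<^sub>R w (?g x)))\<^sup>2) integrable_on {c..d}"
  proof (cases "c \<le> d")
    case True
    have r: "?g c \<in> {a..b}" "?g d \<in> {a..b}" using into True by auto
    have "(\<lambda>t. (norm (w t))\<^sup>2) integrable_on ?g ` {c..d}"
      unfolding affine_image_interval[OF m True]
    proof (rule integrable_on_subinterval[of _ "{a..b}"])
      show "(\<lambda>t. (norm (w t))\<^sup>2) integrable_on {a..b}" using arc unfolding h2_arc_def by blast
    qed (use r in auto)
    then obtain i where "((\<lambda>t. (norm (w t))\<^sup>2) has_integral i) (?g ` {c..d})" by blast
    from has_integral_mult_right[OF has_integral_affine_real[OF this m True], of "(m\<^sup>2)\<^sup>2"]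
    show ?thesis by (auto simp: power_mult_distrib integrable_on_def)
  qed (simp add: integrable_on_empty)
  ultimately show ?thesis unfolding h2_arc_def by blast
qed

section \<open>Closed curves from arcs\<close>

definition periodic_extension :: "(real \<Rightarrow> 'a) \<Rightarrow> real \<Rightarrow> 'a" where
  "periodic_extension g x = g (frac x)"

lemma periodic_int:
  fixes g :: "real \<Rightarrow> 'a"
  assumes "\<And>t. g (t + 1) = g t"
  shows "g (t + of_int n) = g t"
proof (induction n rule: int_induct[of _ 0])
  case (step1 i)
  then show ?case using assms[of "t + of_int i"] by (simp add: algebra_simps)
next
  case (step2 i)
  then show ?case using assms[of "t + of_int (i - 1)"] by (simp add: algebra_simps)
qed simp

lemma periodic_extension_periodic:
  assumes "\<And>t. g (t + 1) = g t"
  shows "periodic_extension g = g"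
proof
  fix x
  have "g (frac x + of_int \<lfloor>x\<rfloor>) = g (frac x)" by (rule periodic_int) (rule assms)
  then show "periodic_extension g x = g x" by (simp add: periodic_extension_def frac_def)
qed

text \<open>
  An arc that closes up to first order is a closed curve, the second derivative being free to jump
  at the closing point.
\<close>

lemma h2_arc_periodic_extension:
  assumes arc: "h2_arc 0 1 f v w" and "f 1 = f 0" "v 1 = v 0"
  shows "h2_arc a b (periodic_extension f) (periodic_extension v) (periodic_extension w)"
proof -
  let ?P = "\<lambda>a b. h2_arc a b (periodic_extension f) (periodic_extension v) (periodic_extension w)"
  have unit: "?P (of_int n) (of_int n + 1)" for n
  proof -
    have sh: "h2_arc (of_int n) (of_int n + 1) (\<lambda>x. f (1 * x + - of_int n))
            (\<lambda>x. 1 *\<^sub>R v (1 * x + - of_int n)) (\<lambda>x. 1\<^sup>2 *\<^sub>R w (1 * x + - of_int n))"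
      by (rule h2_arc_affine[OF arc]) auto
    have "frac x = x - of_int n" if "x \<in> {of_int n..of_int n + 1}" "x \<noteq> of_int n + 1" for x :: real
      using that by (auto simp: frac_def) linarith
    moreover have "frac (of_int n + 1 :: real) = 0" by (simp add: frac_def)
    ultimately have g: "periodic_extension g x = g (x - of_int n)"
      if "x \<in> {of_int n..of_int n + 1}" "x = of_int n + 1 \<longrightarrow> g 1 = g 0" for x and g :: curve
      using that by (cases "x = of_int n + 1") (auto simp: periodic_extension_def)
    show ?thesis
      by (rule h2_arc_cong[OF sh]) (use assms(2,3) g in auto)
  qed
  have "?P (of_int n) (of_int n + real k)" for n k
  proof (induction k)
    case 0
    show ?case using h2_arc_subset[OF unit[of n]] by simp
  next
    case (Suc k)
    have "?P (of_int n + real k) (of_int n + real (Suc k))"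
      using unit[of "n + int k"] by (simp add: algebra_simps)
    from h2_arc_join[OF Suc this] show ?case by simp
  qed
  from h2_arc_subset[OF this[of "\<lfloor>a\<rfloor>" "nat (\<lceil>b\<rceil> - \<lfloor>a\<rfloor>)"], of a b] show ?thesis by linarith
qed

lemma vector_derivative_periodic:
  fixes f :: curve
  assumes "\<And>t. f (t + 1) = f t"
  shows "vector_derivative f (at (t + 1)) = vector_derivative f (at t)"
proof -
  have shift: "(f has_vector_derivative D) (at s)"
    if "(f has_vector_derivative D) (at (s + c))" "\<And>t. f (t + c) = f t" for D s c
  proof -
    have "((\<lambda>t. t + c) has_vector_derivative 1) (at s)" by (auto intro!: derivative_eq_intros)
    from vector_diff_chain_at[OF this that(1)] show ?thesis using that(2) by (simp add: o_def)
  qed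
  have "(f has_vector_derivative D) (at (t + 1)) \<longleftrightarrow> (f has_vector_derivative D) (at t)" for D
    using shift[of D t 1] shift[of D "t + 1" "-1"] assms assms[of "_ - 1"] by auto
  then show ?thesis by (simp add: vector_derivative_def)
qed

lemma regular_curve_periodic:
  assumes "regular_closed_curve \<gamma>"
  shows "\<gamma> (t + 1) = \<gamma> t" "velocity \<gamma> (t + 1) = velocity \<gamma> t" "acceleration \<gamma> (t + 1) = acceleration \<gamma> t"
proof -
  show 1: "\<gamma> (t + 1) = \<gamma> t" for t using assms by (simp add: regular_closed_curve_def)
  show 2: "velocity \<gamma> (t + 1) = velocity \<gamma> t" for t
    unfolding velocity_def by (rule vector_derivative_periodic) (rule 1)
  show "acceleration \<gamma> (t + 1) = acceleration \<gamma> t"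
    unfolding acceleration_def by (rule vector_derivative_periodic) (rule 2)
qed

text \<open>
  Square integrability is known on one period only; extending the arc over that period, which
  reproduces the curve, transports it to all intervals.
\<close>

lemma regular_h2_arc:
  assumes "regular_closed_curve \<gamma>"
  shows "h2_arc a b \<gamma> (velocity \<gamma>) (acceleration \<gamma>)"
proof -
  have arc01: "h2_arc 0 1 \<gamma> (velocity \<gamma>) (acceleration \<gamma>)"
    unfolding h2_arc_def
  proof (intro conjI ballI allI impI)
    show "(\<gamma> has_vector_derivative velocity \<gamma> t) (at t within {0..1})" for t
      using assms unfolding regular_closed_curve_def velocity_def
      by (meson has_vector_derivative_at_within vector_derivative_works)
    show "(acceleration \<gamma> has_integral velocity \<gamma> y - velocity \<gamma> x) {x..y}" if "x \<le> y" for x y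
      using assms that unfolding regular_closed_curve_def by blast
    obtain N where "negligible N" "{t. \<not> velocity \<gamma> differentiable (at t)} \<subseteq> N"
      using assms unfolding regular_closed_curve_def eventually_ae_filter_negligible by blast
    then show "\<exists>N. negligible N \<and>
        (\<forall>t\<in>{0<..<1} - N. (velocity \<gamma> has_vector_derivative acceleration \<gamma> t) (at t))"
      unfolding acceleration_def by (intro exI[of _ N]) (auto simp: vector_derivative_works)
    show "(\<lambda>t. (norm (acceleration \<gamma> t))\<^sup>2) integrable_on {0..1}"
      using assms unfolding regular_closed_curve_def by (simp add: absolutely_integrable_on_iff_nonneg)
  qed
  note periodic = regular_curve_periodic[OF assms]
  from h2_arc_periodic_extension[OF arc01] show ?thesis
    using periodic[of 0] by (simp add: periodic_extension_periodic periodic)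
qed

text \<open>
  The acceleration of the resulting curve is its own vector derivative, and agrees with the carried
  function only off a null set; integrals do not distinguish them.
\<close>

lemma h2_arc_regular:
  assumes arc: "\<And>a b. h2_arc a b f v w" and "\<And>t. f (t + 1) = f t" and "\<And>t. v t \<noteq> 0"
  shows "regular_closed_curve f" and "velocity f = v"
    and "\<exists>N. negligible N \<and> (\<forall>t. t \<notin> N \<longrightarrow> acceleration f t = w t)"
proof -
  have der: "(f has_vector_derivative v t) (at t)" for t
  proof -
    have "(f has_vector_derivative v t) (at t within {t - 1..t + 1})"
      using arc[of "t - 1" "t + 1"] unfolding h2_arc_def by auto
    then show ?thesis by (simp add: at_within_Icc_at)
  qed
  then show vel: "velocity f = v" by (auto simp: velocity_def vector_derivative_at)
  have "\<forall>n. \<exists>N. negligible N \<and>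
      (\<forall>t \<in> {- real n<..<real n} - N. (v has_vector_derivative w t) (at t))"
    using arc unfolding h2_arc_def by blast
  then obtain M where M: "\<And>n. negligible (M n)"
    "\<And>n t. t \<in> {- real n<..<real n} - M n \<Longrightarrow> (v has_vector_derivative w t) (at t)" by metis
  define N where "N = (\<Union>n. M n)"
  have N: "negligible N" unfolding N_def using M(1) by (rule negligible_Union_nat)
  have derv: "(v has_vector_derivative w t) (at t)" if "t \<notin> N" for t
  proof -
    obtain n where "\<bar>t\<bar> < real n" using reals_Archimedean2 by blast
    then have "t \<in> {- real n<..<real n}" by (auto simp: abs_less_iff)
    then show ?thesis using M(2)[of t n] that by (auto simp: N_def)
  qed
  have acc: "acceleration f t = w t" if "t \<notin> N" for t
    using derv[OF that] by (simp add: acceleration_def vel vector_derivative_at)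
  then show "\<exists>N. negligible N \<and> (\<forall>t. t \<notin> N \<longrightarrow> acceleration f t = w t)" using N by blast
  show "regular_closed_curve f"
    unfolding regular_closed_curve_def vel
  proof (intro conjI allI impI)
    show "f differentiable (at t)" for t using der differentiableI_vector by blast
    show "AE t in lebesgue. v differentiable (at t)"
      unfolding eventually_ae_filter_negligible using N derv differentiableI_vector by blast
    show "(acceleration f has_integral v b - v a) {a..b}" if "a \<le> b" for a b
    proof (rule has_integral_spike[OF N])
      show "(w has_integral v b - v a) {a..b}" using arc[of a b] that unfolding h2_arc_def by simp
    qed (use acc in auto)
    have "(\<lambda>t. (norm (acceleration f t))\<^sup>2) integrable_on {0..1}"
    proof (rule integrable_spike[OF _ N])
      show "(\<lambda>t. (norm (w t))\<^sup>2) integrable_on {0..1}" using arc[of 0 1] unfolding h2_arc_def by simp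
    qed (use acc in auto)
    then show "(\<lambda>t. (norm (acceleration f t))\<^sup>2) absolutely_integrable_on {0..1}"
      by (simp add: absolutely_integrable_on_iff_nonneg)
  qed (use assms in auto)
qed

section \<open>Energy at constant speed\<close>

text \<open>
  Differentiating \<open>|\<gamma>'|\<^sup>2 = c\<^sup>2\<close> shows that the acceleration is orthogonal to the velocity, so the
  determinant in the curvature is \<open>c |\<gamma>''|\<close> up to sign by Lagrange's identity.
\<close>

lemma constant_speed_curvature:
  assumes speed: "\<And>t. norm (velocity \<gamma> t) = c" and c: "c > 0"
    and diff: "velocity \<gamma> differentiable (at t)"
  shows "(curvature \<gamma> t)\<^sup>2 * norm (velocity \<gamma> t) = (norm (acceleration \<gamma> t))\<^sup>2 / c ^ 3"
proof -
  let ?v = "velocity \<gamma> t" and ?a = "acceleration \<gamma> t"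
  have d: "(velocity \<gamma> has_vector_derivative ?a) (at t)"
    using diff by (simp add: acceleration_def vector_derivative_works)
  have "((\<lambda>t. velocity \<gamma> t \<bullet> velocity \<gamma> t) has_derivative (\<lambda>h. ?v \<bullet> (h *\<^sub>R ?a) + (h *\<^sub>R ?a) \<bullet> ?v)) (at t)"
    using d unfolding has_vector_derivative_def by (intro has_derivative_inner)
  moreover have "((\<lambda>t. velocity \<gamma> t \<bullet> velocity \<gamma> t) has_derivative (\<lambda>h. 0)) (at t)"
    by (simp add: dot_square_norm speed)
  ultimately have "(\<lambda>h. ?v \<bullet> (h *\<^sub>R ?a) + (h *\<^sub>R ?a) \<bullet> ?v) = (\<lambda>h. 0)"
    by (rule has_derivative_unique)
  from fun_cong[OF this, of 1] have "?v \<bullet> ?a = 0" by (simp add: inner_commute)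
  then have orth: "?v $ 1 * ?a $ 1 + ?v $ 2 * ?a $ 2 = 0"
    by (simp add: inner_vec_def sum_2)
  have nv: "(?v $ 1)\<^sup>2 + (?v $ 2)\<^sup>2 = c\<^sup>2"
    unfolding speed[of t, symmetric]
    by (simp only: power2_norm_eq_inner) (simp add: inner_vec_def sum_2 power2_eq_square)
  have na: "(?a $ 1)\<^sup>2 + (?a $ 2)\<^sup>2 = (norm ?a)\<^sup>2"
    by (simp only: power2_norm_eq_inner) (simp add: inner_vec_def sum_2 power2_eq_square)
  have "(?v $ 1 * ?a $ 2 - ?v $ 2 * ?a $ 1)\<^sup>2
      = ((?v $ 1)\<^sup>2 + (?v $ 2)\<^sup>2) * ((?a $ 1)\<^sup>2 + (?a $ 2)\<^sup>2) - (?v $ 1 * ?a $ 1 + ?v $ 2 * ?a $ 2)\<^sup>2"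
    by (simp add: power2_eq_square algebra_simps)
  also have "\<dots> = c\<^sup>2 * (norm ?a)\<^sup>2" using orth nv na by simp
  finally show ?thesis using c unfolding curvature_def speed
    by (simp add: power_divide power_mult_distrib power2_eq_square power3_eq_cube field_simps)
qed

lemma constant_speed_arc_energy:
  assumes reg: "regular_closed_curve \<gamma>" and speed: "\<And>t. norm (velocity \<gamma> t) = c"
  shows "arc_energy \<gamma> a b = integral {a..b} (\<lambda>t. (norm (acceleration \<gamma> t))\<^sup>2) / c ^ 3"
proof -
  have c: "c > 0" using reg speed unfolding regular_closed_curve_def by metis
  obtain N where N: "negligible N" "{t. \<not> velocity \<gamma> differentiable (at t)} \<subseteq> N"
      using reg unfolding regular_closed_curve_def eventually_ae_filter_negligible by blast
  have "arc_energy \<gamma> a b = integral {a..b} (\<lambda>t. (norm (acceleration \<gamma> t))\<^sup>2 / c ^ 3)"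
    unfolding arc_energy_def
    by (rule integral_spike[OF N(1)]) (use N(2) constant_speed_curvature[OF speed c, symmetric] in auto)
  then show ?thesis by simp
qed

section \<open>Energy comparison with curves made from arcs of the minimiser\<close>

text \<open>
  All competitors are built from arcs of the minimiser, run at a common multiple of its speed, so the
  energy can always be computed from the constant-speed formula.
\<close>

locale constant_speed_minimiser =
  fixes \<Omega> :: "(real ^ 2) set" and \<gamma> :: curve and c :: real
  assumes minimal: "minimal_curve \<Omega> \<gamma>"
    and speed: "\<And>t. norm (velocity \<gamma> t) = c"
begin

lemma regular: "regular_closed_curve \<gamma>"
  using minimal by (simp add: minimal_curve_def admissible_def)

lemma speed_pos: "c > 0"
  using regular speed unfolding regular_closed_curve_def by metis

lemmas periodic = regular_curve_periodic[OF regular]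

lemmas arc = regular_h2_arc[OF regular]

lemmas energy_eq = constant_speed_arc_energy[OF regular speed]

lemma curve_int: "\<gamma> (t + of_int n) = \<gamma> t" "velocity \<gamma> (t + of_int n) = velocity \<gamma> t"
    "acceleration \<gamma> (t + of_int n) = acceleration \<gamma> t"
  using periodic by (auto intro!: periodic_int)

lemma velocity_int_diff:
  assumes "t - s \<in> \<int>" shows "velocity \<gamma> t = velocity \<gamma> s"
proof -
  obtain n where "t - s = of_int n" using assms by (elim Ints_cases)
  then show ?thesis using curve_int(2)[of s n] by (simp add: algebra_simps)
qed

lemma curve_int_diff:
  assumes "t - s \<in> \<int>" shows "\<gamma> t = \<gamma> s"
proof -
  obtain n where "t - s = of_int n" using assms by (elim Ints_cases)
  then show ?thesis using curve_int(1)[of s n] by (simp add: algebra_simps)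
qed

lemma acceleration_integrable:
  "(\<lambda>t. (norm (acceleration \<gamma> t))\<^sup>2) integrable_on {a..b}"
  using arc[of a b] by (simp add: h2_arc_def)

lemma energy_add:
  assumes "x \<le> y" "y \<le> z"
  shows "arc_energy \<gamma> x y + arc_energy \<gamma> y z = arc_energy \<gamma> x z"
  unfolding energy_eq add_divide_distrib[symmetric]
  using Henstock_Kurzweil_Integration.integral_combine[OF assms acceleration_integrable] by simp

lemma energy_affine:
  assumes m: "m \<noteq> 0" and "x \<le> y"
  shows "integral {x..y} (\<lambda>t. (norm (m\<^sup>2 *\<^sub>R acceleration \<gamma> (m * t + k)))\<^sup>2)
    = (\<bar>m\<bar> * c) ^ 3 * arc_energy \<gamma> (min (m*x+k) (m*y+k)) (max (m*x+k) (m*y+k))"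
proof -
  let ?h = "\<lambda>t. (norm (acceleration \<gamma> t))\<^sup>2"
  have "(?h has_integral integral {min (m*x+k) (m*y+k)..max (m*x+k) (m*y+k)} ?h)
          ((\<lambda>t. m * t + k) ` {x..y})"
    unfolding affine_image_interval[OF assms] using acceleration_integrable by (rule integrable_integral)
  from has_integral_mult_right[OF has_integral_affine_real[OF this assms], of "(m\<^sup>2)\<^sup>2"]
  have "integral {x..y} (\<lambda>t. (norm (m\<^sup>2 *\<^sub>R acceleration \<gamma> (m * t + k)))\<^sup>2)
    = (m\<^sup>2)\<^sup>2 * (integral {min (m*x+k) (m*y+k)..max (m*x+k) (m*y+k)} ?h / \<bar>m\<bar>)"
    by (intro integral_unique) (simp add: power_mult_distrib divide_inverse mult.commute)
  moreover have "(m\<^sup>2)\<^sup>2 = \<bar>m\<bar> ^ 3 * \<bar>m\<bar>"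
    by (simp add: power2_eq_square power3_eq_cube abs_if)
  ultimately show ?thesis unfolding energy_eq using m speed_pos
    by (simp add: power_mult_distrib)
qed

lemma energy_shift: "arc_energy \<gamma> (a + of_int n) (b + of_int n) = arc_energy \<gamma> a b"
proof (cases "a \<le> b")
  case True
  from energy_affine[of 1 a b "of_int n"] True show ?thesis
    using speed_pos by (simp add: curve_int energy_eq)
next
  case False
  then show ?thesis by (simp add: arc_energy_def)
qed

lemma energy_period: "arc_energy \<gamma> t (t + 1) = bending_energy \<gamma>"
proof -
  let ?n = "of_int \<lfloor>t\<rfloor> :: real"
  have n: "?n \<le> t" "t \<le> ?n + 1" by linarith+
  have "arc_energy \<gamma> t (t + 1) = arc_energy \<gamma> t (?n + 1) + arc_energy \<gamma> (?n + 1) (t + 1)"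
    using energy_add[of t "?n + 1" "t + 1"] n by simp
  also have "arc_energy \<gamma> (?n + 1) (t + 1) = arc_energy \<gamma> ?n t"
    using energy_shift[of ?n 1 t] by simp
  also have "arc_energy \<gamma> t (?n + 1) + arc_energy \<gamma> ?n t = arc_energy \<gamma> ?n (?n + 1)"
    using energy_add[of ?n t "?n + 1"] n by simp
  also have "\<dots> = bending_energy \<gamma>"
    using energy_shift[of 0 "\<lfloor>t\<rfloor>" 1] by (simp add: bending_energy_def add.commute)
  finally show ?thesis .
qed

text \<open>
  A closed curve of zero energy would have zero acceleration, hence be a straight segment run at
  positive speed, which does not close up.
\<close>

lemma bending_energy_pos: "bending_energy \<gamma> > 0"
proof (rule ccontr)
  let ?a = "acceleration \<gamma>"
  let ?h = "\<lambda>t. (norm (?a t))\<^sup>2"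
  assume "\<not> bending_energy \<gamma> > 0"
  then have le: "integral {0..1} ?h \<le> 0"
    using speed_pos by (simp add: bending_energy_def energy_eq divide_le_0_iff not_less)
  have const: "velocity \<gamma> x = velocity \<gamma> 0" if x: "x \<in> {0..1}" for x
  proof -
    have ai: "(?a has_integral (velocity \<gamma> x - velocity \<gamma> 0)) {0..x}"
      using arc[of 0 1] x by (simp add: h2_arc_def)
    have h0: "integral {0..x} ?h \<le> 0"
      using integral_subset_le[OF _ acceleration_integrable acceleration_integrable, of 0 x 0 1] x le by auto
    \<comment> \<open>From a vanishing \<open>L\<^sup>2\<close> norm to a vanishing integral by \<open>|a| \<le> e + |a|\<^sup>2 / e\<close> for every \<open>e > 0\<close>.\<close>
    have "norm (velocity \<gamma> x - velocity \<gamma> 0) \<le> e" if e: "e > 0" for e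
    proof -
      have gi: "(\<lambda>t. e + ?h t / e) integrable_on {0..x}"
        by (intro integrable_add integrable_on_divide acceleration_integrable) auto
      have "norm (integral {0..x} ?a) \<le> integral {0..x} (\<lambda>t. e + ?h t / e)"
      proof (rule integral_norm_bound_integral[OF _ gi])
        fix t
        have "norm (?a t) * e \<le> e * e + norm (?a t) * norm (?a t)"
          using e by (smt (verit) mult_left_mono mult_right_mono norm_ge_zero mult_nonneg_nonneg)
        then show "norm (?a t) \<le> e + ?h t / e"
          using e by (simp add: field_simps power2_eq_square)
      qed (use ai in blast)
      also have "\<dots> = e * x + integral {0..x} ?h / e"
        using x by (subst Henstock_Kurzweil_Integration.integral_add)
           (auto intro: integrable_on_divide acceleration_integrable)
      also have "\<dots> \<le> e"
        using h0 e x by (smt (verit) atLeastAtMost_iff divide_nonpos_pos mult_left_le)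
      finally show ?thesis using ai by (simp add: integral_unique)
    qed
    then have "norm (velocity \<gamma> x - velocity \<gamma> 0) \<le> 0" by (meson dense_ge)
    then show ?thesis by simp
  qed
  have "(velocity \<gamma> has_integral \<gamma> 1 - \<gamma> 0) {0..1}"
    by (rule fundamental_theorem_of_calculus) (use arc[of 0 1] in \<open>auto simp: h2_arc_def\<close>)
  moreover have "(velocity \<gamma> has_integral velocity \<gamma> 0) {0..1}"
    by (rule has_integral_eq[of _ "\<lambda>_. velocity \<gamma> 0"])
       (simp_all add: const[symmetric] has_integral_const_real[of "velocity \<gamma> 0" 0 1, simplified])
  ultimately have "velocity \<gamma> 0 = \<gamma> 1 - \<gamma> 0" by (rule has_integral_unique[rotated])
  then show False using periodic(1)[of 0] speed[of 0] speed_pos by simp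
qed

text \<open>
  The competitor passes only through points of the minimiser, with velocities parallel to those of the
  minimiser there. Two of its times meeting at a point therefore come from two times of the minimiser
  at that point, whose velocities are parallel by admissibility, or from the same time. So every such
  competitor is admissible, even when it runs along an arc of the minimiser several times.
\<close>

lemma energy_le_closed_arc:
  assumes "h2_arc 0 1 f v w" and close: "f 1 = f 0" "v 1 = v 0" and L: "L > 0"
    and tangent: "\<And>x. x \<in> {0..1} \<Longrightarrow>
      \<exists>y m. \<bar>m\<bar> = L \<and> f x = \<gamma> y \<and> v x = m *\<^sub>R velocity \<gamma> y"
  shows "bending_energy \<gamma> \<le> integral {0..1} (\<lambda>t. (norm (w t))\<^sup>2) / (L * c) ^ 3"
proof -
  let ?f = "periodic_extension f" and ?v = "periodic_extension v" and ?w = "periodic_extension w"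
  have tan: "\<exists>y m. \<bar>m\<bar> = L \<and> ?f x = \<gamma> y \<and> ?v x = m *\<^sub>R velocity \<gamma> y" for x
    using tangent[of "frac x"] frac_ge_0[of x] frac_lt_1[of x]
    unfolding periodic_extension_def by force
  have sp: "norm (?v x) = L * c" for x
    using tan[of x] speed by auto
  have harc: "h2_arc a b ?f ?v ?w" for a b
    by (rule h2_arc_periodic_extension[OF assms(1) close])
  have per: "?f (t + 1) = ?f t" for t
    by (simp add: periodic_extension_def frac_def)
  have nz: "?v t \<noteq> 0" for t using sp[of t] L speed_pos by auto
  note eta = h2_arc_regular[OF harc per nz]
  have "range ?f \<subseteq> closure \<Omega>"
    using minimal tan unfolding minimal_curve_def admissible_def by fastforce
  moreover have "\<exists>k. ?v t = k *\<^sub>R ?v s" if ts: "?f t = ?f s" for t s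
  proof -
    obtain y m where y: "\<bar>m\<bar> = L" "?f t = \<gamma> y" "?v t = m *\<^sub>R velocity \<gamma> y" using tan by blast
    obtain z l where z: "\<bar>l\<bar> = L" "?f s = \<gamma> z" "?v s = l *\<^sub>R velocity \<gamma> z" using tan by blast
    have "\<exists>k. velocity \<gamma> y = k *\<^sub>R velocity \<gamma> z"
    proof (cases "y - z \<in> \<int>")
      case True
      then show ?thesis using velocity_int_diff by (metis scaleR_one)
    next
      case False
      then have "self_contact_couple \<gamma> y z"
        using ts y z by (simp add: self_contact_couple_def)
      then show ?thesis using minimal unfolding minimal_curve_def admissible_def by blast
    qed
    then obtain k where "velocity \<gamma> y = k *\<^sub>R velocity \<gamma> z" by blast
    then have "?v t = (m * k / l) *\<^sub>R ?v s" using y z L by auto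
    then show ?thesis by blast
  qed
  ultimately have "admissible \<Omega> ?f"
    unfolding admissible_def self_contact_couple_def eta(2) using eta(1) by blast
  then have "bending_energy \<gamma> \<le> bending_energy ?f"
    using minimal unfolding minimal_curve_def by blast
  also have "\<dots> = integral {0..1} (\<lambda>t. (norm (acceleration ?f t))\<^sup>2) / (L * c) ^ 3"
    unfolding bending_energy_def
    by (rule constant_speed_arc_energy[OF eta(1)]) (simp add: eta(2) sp)
  also have "integral {0..1} (\<lambda>t. (norm (acceleration ?f t))\<^sup>2) = integral {0..1} (\<lambda>t. (norm (w t))\<^sup>2)"
  proof -
    obtain N where N: "negligible N" "\<And>t. t \<notin> N \<Longrightarrow> acceleration ?f t = ?w t" using eta(3) by blast
    show ?thesis
    proof (rule integral_spike)
      show "negligible (N \<union> {1})" using N by simp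
      show "(norm (w t))\<^sup>2 = (norm (acceleration ?f t))\<^sup>2" if "t \<in> {0..1} - (N \<union> {1})" for t
      proof -
        have "frac t = t" using that by (subst frac_eq) auto
        then show ?thesis using that N(2)[of t] by (simp add: periodic_extension_def)
      qed
    qed
  qed
  finally show ?thesis .
qed

text \<open>
  A sub-arc that closes up with equal velocities at its ends is itself a competitor.
\<close>

lemma energy_le_loop:
  assumes pq: "p < q" and "\<gamma> p = \<gamma> q" "velocity \<gamma> p = velocity \<gamma> q"
  shows "bending_energy \<gamma> \<le> arc_energy \<gamma> p q"
proof -
  define L where "L = q - p"
  have L: "L > 0" "L + p = q" using pq by (auto simp: L_def)
  have "h2_arc 0 1 (\<lambda>x. \<gamma> (L * x + p)) (\<lambda>x. L *\<^sub>R velocity \<gamma> (L * x + p))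
      (\<lambda>x. L\<^sup>2 *\<^sub>R acceleration \<gamma> (L * x + p))"
    by (rule h2_arc_affine[OF arc[of p q]]) (use L in \<open>auto simp: mult_left_le simp flip: L(2)\<close>)
  moreover have "\<exists>y m. \<bar>m\<bar> = L \<and> \<gamma> (L * x + p) = \<gamma> y \<and> L *\<^sub>R velocity \<gamma> (L * x + p) = m *\<^sub>R velocity \<gamma> y" for x
    using L by (intro exI[of _ "L * x + p"] exI[of _ L]) simp
  ultimately have "bending_energy \<gamma> \<le> integral {0..1} (\<lambda>t. (norm (L\<^sup>2 *\<^sub>R acceleration \<gamma> (L * t + p)))\<^sup>2) / (L * c) ^ 3"
    using L(1) assms(2,3)
    by (intro energy_le_closed_arc[where f = "\<lambda>x. \<gamma> (L * x + p)"
          and v = "\<lambda>x. L *\<^sub>R velocity \<gamma> (L * x + p)"]) (simp_all add: L(2))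
  also have "\<dots> = arc_energy \<gamma> p q"
    using L pq speed_pos by (subst energy_affine) auto
  finally show ?thesis .
qed

text \<open>
  The competitor follows the arc from \<open>p\<close> to \<open>q\<close> forwards, jumps from \<open>q\<close> to \<open>u\<close> and follows the arc
  from \<open>r\<close> to \<open>u\<close> backwards, which brings it to \<open>r\<close> and hence to its start. Opposite velocities at
  the two jumps become equal ones under the reversal. The two arcs may overlap; an overlap is then
  run twice, once in each direction. This single construction yields all surgeries below.
\<close>

lemma energy_le_loop_with_reversal:
  assumes pq: "p < q" and ru: "r < u"
    and turn: "\<gamma> q = \<gamma> u" "velocity \<gamma> q = - velocity \<gamma> u"
    and close: "\<gamma> p = \<gamma> r" "velocity \<gamma> p = - velocity \<gamma> r"
  shows "bending_energy \<gamma> \<le> arc_energy \<gamma> p q + arc_energy \<gamma> r u"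
proof -
  define L where "L = (q - p) + (u - r)"
  define b where "b = (q - p) / L"
  define k where "k = u + L * b"
  have L: "L > 0" using pq ru by (auto simp: L_def)
  have Lb: "L * b = q - p" using L by (simp add: b_def)
  have b: "0 < b" "b < 1" using pq ru L by (auto simp: b_def L_def)
  have ends: "L * b + p = q" "- L * b + k = u" "- L + k = r"
    by (simp_all add: k_def Lb) (simp add: L_def)
  \<comment> \<open>Parameter \<open>b\<close> is where the arcs are switched; both are run with \<open>L\<close> times the original speed,
    and \<open>L\<close> is the total parameter length, so that the competitor has period one.\<close>
  define f where "f x = (if x \<le> b then \<gamma> (L * x + p) else \<gamma> (- L * x + k))" for x
  define v where "v x = (if x \<le> b then L *\<^sub>R velocity \<gamma> (L * x + p)
    else - L *\<^sub>R velocity \<gamma> (- L * x + k))" for x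
  define w where "w x = (if x \<le> b then L\<^sup>2 *\<^sub>R acceleration \<gamma> (L * x + p)
    else (- L)\<^sup>2 *\<^sub>R acceleration \<gamma> (- L * x + k))" for x
  have fwd: "h2_arc 0 b (\<lambda>x. \<gamma> (L * x + p)) (\<lambda>x. L *\<^sub>R velocity \<gamma> (L * x + p))
      (\<lambda>x. L\<^sup>2 *\<^sub>R acceleration \<gamma> (L * x + p))"
    by (rule h2_arc_affine[OF arc[of p "L * b + p"]]) (use L in auto)
  have bwd: "h2_arc b 1 (\<lambda>x. \<gamma> (- L * x + k)) (\<lambda>x. - L *\<^sub>R velocity \<gamma> (- L * x + k))
      (\<lambda>x. (- L)\<^sup>2 *\<^sub>R acceleration \<gamma> (- L * x + k))"
    by (rule h2_arc_affine[OF arc[of "- L + k" "- L * b + k"]]) (use L in auto)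
  have "h2_arc 0 b f v w"
    by (rule h2_arc_cong[OF fwd]) (auto simp: f_def v_def w_def)
  moreover have "h2_arc b 1 f v w"
    by (rule h2_arc_cong[OF bwd]) (use turn ends in \<open>auto simp: f_def v_def w_def\<close>)
  ultimately have farc: "h2_arc 0 1 f v w"
    by (rule h2_arc_join) (use b in auto)
  have "bending_energy \<gamma> \<le> integral {0..1} (\<lambda>t. (norm (w t))\<^sup>2) / (L * c) ^ 3"
  proof (rule energy_le_closed_arc[OF farc _ _ L])
    show "f 1 = f 0" "v 1 = v 0" using b ends close by (auto simp: f_def v_def)
    show "\<exists>y m. \<bar>m\<bar> = L \<and> f x = \<gamma> y \<and> v x = m *\<^sub>R velocity \<gamma> y" for x
      using L by (intro exI[of _ "if x \<le> b then L * x + p else - L * x + k"]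
          exI[of _ "if x \<le> b then L else - L"]) (simp add: f_def v_def)
  qed
  also have "integral {0..1} (\<lambda>t. (norm (w t))\<^sup>2)
      = integral {0..b} (\<lambda>t. (norm (w t))\<^sup>2) + integral {b..1} (\<lambda>t. (norm (w t))\<^sup>2)"
    using farc b by (subst Henstock_Kurzweil_Integration.integral_combine) (auto simp: h2_arc_def)
  also have "integral {0..b} (\<lambda>t. (norm (w t))\<^sup>2)
      = integral {0..b} (\<lambda>t. (norm (L\<^sup>2 *\<^sub>R acceleration \<gamma> (L * t + p)))\<^sup>2)"
    by (rule integral_cong) (simp add: w_def)
  also have "\<dots> = (L * c) ^ 3 * arc_energy \<gamma> p q"
    using L b pq ends by (subst energy_affine) auto
  also have "integral {b..1} (\<lambda>t. (norm (w t))\<^sup>2)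
      = integral {b..1} (\<lambda>t. (norm ((- L)\<^sup>2 *\<^sub>R acceleration \<gamma> (- L * t + k)))\<^sup>2)"
    by (rule integral_spike[of "{b}"]) (auto simp: w_def)
  also have "\<dots> = (L * c) ^ 3 * arc_energy \<gamma> r u"
    using L b ru ends by (subst energy_affine) auto
  finally show ?thesis using L speed_pos by (simp add: add_divide_distrib)
qed

section \<open>Self-contacts of a minimiser\<close>

lemma contact_sym: "self_contact_couple \<gamma> t s \<Longrightarrow> self_contact_couple \<gamma> s t"
  unfolding self_contact_couple_def by (metis Ints_minus minus_diff_eq)

lemma contact_shift:
  "self_contact_couple \<gamma> t (s + of_int n) \<longleftrightarrow> self_contact_couple \<gamma> t s"
proof -
  have "t - s \<in> \<int>" if "t - (s + of_int n) \<in> \<int>"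
    using Ints_add[OF that Ints_of_int[of n]] by simp
  moreover have "t - (s + of_int n) \<in> \<int>" if "t - s \<in> \<int>"
    using Ints_diff[OF that Ints_of_int[of n]] by (simp add: diff_diff_eq)
  ultimately have "t - (s + of_int n) \<in> \<int> \<longleftrightarrow> t - s \<in> \<int>" by blast
  then show ?thesis by (simp add: self_contact_couple_def curve_int)
qed

lemma contact_next_turn:
  assumes "self_contact_couple \<gamma> t s"
  shows "self_contact_couple \<gamma> (t + 1) (s + 1)"
  using contact_shift[of "t + 1" s 1] contact_shift[of s t 1] contact_sym[OF assms]
    contact_sym[of s "t + 1"] by simp

lemma contact_representative:
  assumes "self_contact_couple \<gamma> t s"
  obtains n where "t < s + of_int n" "s + of_int n < t + 1" "self_contact_couple \<gamma> t (s + of_int n)"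
proof -
  have "s - t \<notin> \<int>" using contact_sym[OF assms] by (simp add: self_contact_couple_def)
  then have "frac (s - t) \<noteq> 0" by simp
  then have "0 < frac (s - t)" using frac_ge_0[of "s - t"] by linarith
  then have "t < s + of_int (- \<lfloor>s - t\<rfloor>)" "s + of_int (- \<lfloor>s - t\<rfloor>) < t + 1"
    using frac_lt_1[of "s - t"] unfolding frac_def by linarith+
  then show thesis using that assms contact_shift by blast
qed

lemma not_int_near:
  fixes a b :: real
  assumes "a < b" "b < a + 1"
  shows "a - b \<notin> \<int>"
proof
  assume "a - b \<in> \<int>"
  with assms obtain n where "a - b = of_int n" "-1 < a - b" "a - b < 0" by (auto elim!: Ints_cases)
  then have "-1 < n" "n < 0" by linarith+
  then show False by simp
qed

text \<open>
  Constant speed and parallelism leave equality as the only alternative. But then each of the two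
  arcs between the contact times is a competitor, while their energies add up to the minimum, which is
  positive.
\<close>

lemma contact_opposite:
  assumes "self_contact_couple \<gamma> t s"
  shows "velocity \<gamma> t = - velocity \<gamma> s"
proof -
  obtain n where n: "t < s + of_int n" "s + of_int n < t + 1" "self_contact_couple \<gamma> t (s + of_int n)"
    using contact_representative[OF assms] .
  define r where "r = s + of_int n"
  have r: "t < r" "r < t + 1" "\<gamma> t = \<gamma> r" "velocity \<gamma> r = velocity \<gamma> s"
    using n by (auto simp: r_def self_contact_couple_def curve_int)
  obtain k where k: "velocity \<gamma> t = k *\<^sub>R velocity \<gamma> r"
    using minimal n(3) unfolding minimal_curve_def admissible_def r_def by blast
  have "\<bar>k\<bar> * c = c" using arg_cong[OF k, of norm] by (simp add: speed)
  then have "\<bar>k\<bar> = 1" using speed_pos by simp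
  moreover have "k \<noteq> 1"
  proof
    assume "k = 1"
    then have v: "velocity \<gamma> t = velocity \<gamma> r" using k by simp
    have "bending_energy \<gamma> \<le> arc_energy \<gamma> t r"
      by (rule energy_le_loop) (use r v in auto)
    moreover have "bending_energy \<gamma> \<le> arc_energy \<gamma> r (t + 1)"
      by (rule energy_le_loop) (use r v periodic in auto)
    moreover have "arc_energy \<gamma> t r + arc_energy \<gamma> r (t + 1) = bending_energy \<gamma>"
      using energy_add[of t r "t + 1"] r energy_period by simp
    ultimately show False using bending_energy_pos by simp
  qed
  ultimately show ?thesis using k r by (auto simp: abs_if split: if_splits)
qed

lemma velocity_not_opposite_self: "velocity \<gamma> t \<noteq> - velocity \<gamma> t"
proof
  assume "velocity \<gamma> t = - velocity \<gamma> t"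
  then have "velocity \<gamma> t = 0" by (simp add: eq_neg_iff_add_eq_0 flip: scaleR_2)
  then show False using speed[of t] speed_pos by simp
qed

text \<open>
  Of three parallel velocities of equal norm, two are equal.
\<close>

lemma contact_unique:
  assumes "self_contact_couple \<gamma> t s" "self_contact_couple \<gamma> t r"
  shows "s - r \<in> \<int>"
proof (rule ccontr)
  assume "s - r \<notin> \<int>"
  then have "self_contact_couple \<gamma> s r"
    using assms by (auto simp: self_contact_couple_def)
  from contact_opposite[OF this] contact_opposite[OF assms(1)] contact_opposite[OF assms(2)]
  have "velocity \<gamma> r = - velocity \<gamma> r" by simp
  then show False using velocity_not_opposite_self by blast
qed

text \<open>
  If the couples \<open>(t, s)\<close> and \<open>(\<tau>, \<sigma>)\<close> interlace, the four arcs between consecutive times pair up,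
  each arc with the opposite one reversed, into two competitors that share the energy of the
  minimiser between them.
\<close>

lemma contact_no_crossing:
  assumes "t < \<tau>" "\<tau> < s" "s < \<sigma>" "\<sigma> < t + 1"
    and "self_contact_couple \<gamma> t s" "self_contact_couple \<gamma> \<tau> \<sigma>"
  shows False
proof -
  have g: "\<gamma> t = \<gamma> s" "\<gamma> \<tau> = \<gamma> \<sigma>" using assms by (auto simp: self_contact_couple_def)
  have v: "velocity \<gamma> t = - velocity \<gamma> s" "velocity \<gamma> \<tau> = - velocity \<gamma> \<sigma>"
    using assms contact_opposite by auto
  have "bending_energy \<gamma> \<le> arc_energy \<gamma> s \<sigma> + arc_energy \<gamma> t \<tau>"
    by (rule energy_le_loop_with_reversal) (use assms g v in auto)
  moreover have "bending_energy \<gamma> \<le> arc_energy \<gamma> \<sigma> (t + 1) + arc_energy \<gamma> \<tau> s"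
    by (rule energy_le_loop_with_reversal) (use assms g v periodic in auto)
  moreover have "arc_energy \<gamma> t \<tau> + arc_energy \<gamma> \<tau> s = arc_energy \<gamma> t s"
    "arc_energy \<gamma> t s + arc_energy \<gamma> s \<sigma> = arc_energy \<gamma> t \<sigma>"
    "arc_energy \<gamma> t \<sigma> + arc_energy \<gamma> \<sigma> (t + 1) = bending_energy \<gamma>"
    using assms energy_add[of t \<tau> s] energy_add[of t s \<sigma>] energy_add[of t \<sigma> "t + 1"] energy_period
    by auto
  ultimately show False using bending_energy_pos by linarith
qed

text \<open>
  Follow the curve from \<open>t\<close> to \<open>\<sigma>\<close> and return along the arc from \<open>s\<close> to \<open>\<tau>\<close> reversed: the competitor
  runs along that arc twice instead of using the arc from \<open>\<sigma>\<close> to \<open>t + 1\<close>.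
\<close>

lemma energy_between_contacts_le:
  assumes "t < s" "s < \<tau>" "\<tau> < \<sigma>" "\<sigma> < t + 1"
    and "self_contact_couple \<gamma> t s" "self_contact_couple \<gamma> \<tau> \<sigma>"
  shows "arc_energy \<gamma> \<sigma> (t + 1) \<le> arc_energy \<gamma> s \<tau>"
proof -
  have g: "\<gamma> t = \<gamma> s" "\<gamma> \<tau> = \<gamma> \<sigma>" using assms by (auto simp: self_contact_couple_def)
  have v: "velocity \<gamma> t = - velocity \<gamma> s" "velocity \<gamma> \<tau> = - velocity \<gamma> \<sigma>"
    using assms contact_opposite by auto
  have "bending_energy \<gamma> \<le> arc_energy \<gamma> t \<sigma> + arc_energy \<gamma> s \<tau>"
    by (rule energy_le_loop_with_reversal) (use assms g v in auto)
  then show ?thesis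
    using energy_add[of t \<sigma> "t + 1"] energy_period[of t] assms by linarith
qed

lemma energy_between_contacts:
  assumes "t < s" "s < \<tau>" "\<tau> < \<sigma>" "\<sigma> < t + 1"
    and ts: "self_contact_couple \<gamma> t s" and "self_contact_couple \<gamma> \<tau> \<sigma>"
  shows "arc_energy \<gamma> s \<tau> = arc_energy \<gamma> \<sigma> (t + 1)"
proof (rule antisym)
  from energy_between_contacts_le[OF _ _ _ _ assms(6) contact_next_turn[OF ts]]
  have "arc_energy \<gamma> (s + 1) (\<tau> + 1) \<le> arc_energy \<gamma> \<sigma> (t + 1)" using assms by simp
  then show "arc_energy \<gamma> s \<tau> \<le> arc_energy \<gamma> \<sigma> (t + 1)" using energy_shift[of s 1 \<tau>] by simp
qed (rule energy_between_contacts_le[OF assms])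

text \<open>
  With equal energies, the competitor that runs along the arc from \<open>s\<close> to \<open>\<tau>\<close> twice is again
  minimal. It would visit the common point of a contact couple \<open>(a, b)\<close> inside that arc four times,
  and cutting it there splits it into two closed competitors whose energies add up to the minimum.
  The two pieces are written down directly.
\<close>

lemma no_contact_between_contacts:
  assumes "t < s" "s < \<tau>" "\<tau> < \<sigma>" "\<sigma> < t + 1"
    and "self_contact_couple \<gamma> t s" "self_contact_couple \<gamma> \<tau> \<sigma>"
  shows "inj_on \<gamma> {s<..<\<tau>}"
proof (rule linorder_inj_onI')
  fix a b assume "a \<in> {s<..<\<tau>}" "b \<in> {s<..<\<tau>}" "a < b"
  then have ab: "s < a" "a < b" "b < \<tau>" by auto
  show "\<gamma> a \<noteq> \<gamma> b"
  proof
    assume eq: "\<gamma> a = \<gamma> b"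
    have con: "self_contact_couple \<gamma> a b"
      unfolding self_contact_couple_def using not_int_near[of a b] ab assms eq by simp
    have g: "\<gamma> t = \<gamma> s" "\<gamma> \<tau> = \<gamma> \<sigma>" using assms by (auto simp: self_contact_couple_def)
    have v: "velocity \<gamma> t = - velocity \<gamma> s" "velocity \<gamma> \<tau> = - velocity \<gamma> \<sigma>"
      "velocity \<gamma> a = - velocity \<gamma> b"
      using assms con contact_opposite by auto
    have "bending_energy \<gamma> \<le> arc_energy \<gamma> a \<sigma> + arc_energy \<gamma> b \<tau>"
      by (rule energy_le_loop_with_reversal) (use assms g v ab eq in auto)
    moreover have "bending_energy \<gamma> \<le> arc_energy \<gamma> t a + arc_energy \<gamma> s b"
      by (rule energy_le_loop_with_reversal) (use assms g v ab eq in auto)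
    moreover have "arc_energy \<gamma> s b + arc_energy \<gamma> b \<tau> = arc_energy \<gamma> s \<tau>"
      "arc_energy \<gamma> t a + arc_energy \<gamma> a \<sigma> = arc_energy \<gamma> t \<sigma>"
      "arc_energy \<gamma> t \<sigma> + arc_energy \<gamma> \<sigma> (t + 1) = bending_energy \<gamma>"
      using assms ab energy_add[of s b \<tau>] energy_add[of t a \<sigma>] energy_add[of t \<sigma> "t + 1"]
        energy_period by auto
    ultimately show False
      using bending_energy_pos energy_between_contacts[OF assms] by linarith
  qed
qed

section \<open>Innermost self-contacts\<close>

text \<open>
  A contact couple of least parameter distance between \<open>p\<close> and \<open>q\<close> is innermost, since the partner of
  a time strictly inside it would have to be inside as well, couples not crossing and points being at
  most double. The least distance is attained because the couples form a compact set: opposite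
  velocities, being nonzero, keep them away from the diagonal.
\<close>

lemma innermost_contact:
  assumes "p < q" "q < p + 1" "self_contact_couple \<gamma> p q"
  obtains t s where "p \<le> t" "t < s" "s \<le> q" "self_contact_couple \<gamma> t s"
    "{t<..<s} \<inter> contact_set \<gamma> = {}"
proof -
  define K where "K = {z \<in> {p..q} \<times> {p..q}. fst z \<le> snd z \<and> \<gamma> (fst z) = \<gamma> (snd z)
    \<and> velocity \<gamma> (fst z) = - velocity \<gamma> (snd z)}"
  have cont: "continuous_on UNIV \<gamma>"
    using regular unfolding regular_closed_curve_def
    by (simp add: continuous_at_imp_continuous_on differentiable_imp_continuous_within)
  have contv: "continuous_on {p..q} (velocity \<gamma>)"
  proof -
    have i: "acceleration \<gamma> integrable_on {p..q}"
      using arc[of p q] assms(1) unfolding h2_arc_def by (meson integrable_on_def less_imp_le order_refl)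
    have eq: "velocity \<gamma> p + integral {p..x} (acceleration \<gamma>) = velocity \<gamma> x" if "x \<in> {p..q}" for x
    proof -
      have "(acceleration \<gamma> has_integral (velocity \<gamma> x - velocity \<gamma> p)) {p..x}"
        using arc[of p q] that unfolding h2_arc_def by simp
      then show ?thesis by (simp add: integral_unique)
    qed
    have "continuous_on {p..q} (\<lambda>x. velocity \<gamma> p + integral {p..x} (acceleration \<gamma>))"
      by (intro continuous_intros indefinite_integral_continuous_1 i)
    then show ?thesis by (rule continuous_on_eq) (rule eq)
  qed
  have cf: "continuous_on ({p..q} \<times> {p..q}) (\<lambda>z. \<gamma> (fst z))" "continuous_on ({p..q} \<times> {p..q}) (\<lambda>z. \<gamma> (snd z))"
    "continuous_on ({p..q} \<times> {p..q}) (\<lambda>z. velocity \<gamma> (fst z))"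
    "continuous_on ({p..q} \<times> {p..q}) (\<lambda>z. velocity \<gamma> (snd z))"
    by (auto intro!: continuous_on_compose2[OF cont] continuous_on_compose2[OF contv] continuous_intros)
  have "closed K"
  proof -
    let ?S = "{p..q} \<times> {p..q}"
    have K: "K = (?S \<inter> (\<lambda>z. fst z - snd z) -` {..0}) \<inter> (?S \<inter> (\<lambda>z. \<gamma> (fst z) - \<gamma> (snd z)) -` {0})
      \<inter> (?S \<inter> (\<lambda>z. velocity \<gamma> (fst z) + velocity \<gamma> (snd z)) -` {0})"
      unfolding K_def by (auto simp: eq_neg_iff_add_eq_0)
    have "closed ?S" by (intro closed_Times closed_atLeastAtMost)
    then show ?thesis unfolding K
      by (intro closed_Int continuous_closed_preimage continuous_intros cf) auto
  qed
  moreover have "bounded K"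
    by (rule bounded_subset[of "{p..q} \<times> {p..q}"]) (auto simp: K_def intro!: bounded_Times)
  ultimately have "compact K" using compact_eq_bounded_closed by blast
  moreover have "(p, q) \<in> K"
    using assms contact_opposite[OF assms(3)] by (auto simp: K_def self_contact_couple_def)
  moreover have "continuous_on K (\<lambda>z. snd z - fst z)" by (intro continuous_intros)
  ultimately obtain z where z: "z \<in> K" "\<And>y. y \<in> K \<Longrightarrow> snd z - fst z \<le> snd y - fst y"
    using continuous_attains_inf[of K "\<lambda>z. snd z - fst z"] by blast
  obtain t s where ts: "z = (t, s)" by (cases z)
  have K: "p \<le> t" "s \<le> q" "t \<le> s" "\<gamma> t = \<gamma> s" "velocity \<gamma> t = - velocity \<gamma> s"
    using z(1) by (auto simp: K_def ts)
  have "t \<noteq> s" using K(5) velocity_not_opposite_self by blast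
  then have lt: "t < s" using K by simp
  have near: "s < t + 1" using K assms by linarith
  have con: "self_contact_couple \<gamma> t s"
    using not_int_near[OF lt near] K by (simp add: self_contact_couple_def)
  have least: "s - t \<le> b - a" if "t \<le> a" "a < b" "b \<le> s" "self_contact_couple \<gamma> a b" for a b
    using z(2)[of "(a, b)"] that K contact_opposite[OF that(4)]
    by (auto simp: K_def ts self_contact_couple_def)
  have "u \<notin> contact_set \<gamma>" if u: "t < u" "u < s" for u
  proof
    assume "u \<in> contact_set \<gamma>"
    then obtain r where "self_contact_couple \<gamma> u r" by (auto simp: contact_set_def)
    then obtain n where n: "u < r + of_int n" "r + of_int n < u + 1" "self_contact_couple \<gamma> u (r + of_int n)"
      using contact_representative by blast
    define w where "w = r + of_int n"
    have w: "u < w" "w < u + 1" "self_contact_couple \<gamma> u w" using n by (auto simp: w_def)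
    have us: "u - s \<notin> \<int>" "t - u \<notin> \<int>" using not_int_near u near by auto
    consider "w < s" | "w = s" | "s < w" "w < t + 1" | "w = t + 1" | "t + 1 < w" by linarith
    then show False
    proof cases
      case 1
      then show False using least[of u w] w u by simp
    next
      case 2
      then show False using contact_unique[of s t u] contact_sym[OF con] contact_sym[OF w(3)] us by simp
    next
      case 3
      then show False using contact_no_crossing[of t u s w] u w con by simp
    next
      case 4
      then have "self_contact_couple \<gamma> u t" using w(3) contact_shift[of u t 1] by simp
      then show False using contact_unique[OF contact_sym[of u t] con] us by simp
    next
      case 5
      have "self_contact_couple \<gamma> u (w - 1)" using w(3) contact_shift[of u w "-1"] by simp
      from contact_sym[OF this] show False using least[of "w - 1" u] 5 w u by simp
    qed
  qed
  then have "{t<..<s} \<inter> contact_set \<gamma> = {}" by auto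
  then show thesis using that K lt con by blast
qed

text \<open>
  Non-crossing couples at different points are either side by side or nested on the line; in the nested
  case the outer couple is replaced by its complementary arc on the circle.
\<close>

lemma disjoint_contacts:
  assumes x: "x \<in> \<gamma> ` contact_set \<gamma>" and y: "y \<in> \<gamma> ` contact_set \<gamma>" and "x \<noteq> y"
  obtains p q p' q' where "p < q" "q < p'" "p' < q'" "q' < p + 1"
    "self_contact_couple \<gamma> p q" "self_contact_couple \<gamma> p' q'"
proof -
  obtain p q0 where p: "\<gamma> p = x" "self_contact_couple \<gamma> p q0" using x by (auto simp: contact_set_def)
  obtain n where "p < q0 + of_int n" "q0 + of_int n < p + 1" "self_contact_couple \<gamma> p (q0 + of_int n)"
    using contact_representative[OF p(2)] .
  then obtain q where q: "p < q" "q < p + 1" "self_contact_couple \<gamma> p q" by blast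
  have gq: "\<gamma> q = x" using q p by (simp add: self_contact_couple_def)
  obtain a0 b0 where a0: "\<gamma> a0 = y" "self_contact_couple \<gamma> a0 b0" using y by (auto simp: contact_set_def)
  have rep: "\<exists>n. p < a + of_int n \<and> a + of_int n < p + 1" if "\<gamma> a = y" for a
  proof -
    have "a - p \<notin> \<int>" using curve_int_diff[of a p] that p \<open>x \<noteq> y\<close> by auto
    then have "frac (a - p) \<noteq> 0" by simp
    then have "0 < frac (a - p)" using frac_ge_0[of "a - p"] by linarith
    then have "p < a + of_int (- \<lfloor>a - p\<rfloor>)" "a + of_int (- \<lfloor>a - p\<rfloor>) < p + 1"
      using frac_lt_1[of "a - p"] unfolding frac_def by linarith+
    then show ?thesis by blast
  qed
  obtain k where k: "p < a0 + of_int k" "a0 + of_int k < p + 1" using rep a0 by blast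
  have "\<gamma> b0 = y" using a0 by (simp add: self_contact_couple_def)
  then obtain l where l: "p < b0 + of_int l" "b0 + of_int l < p + 1" using rep by blast
  define a where "a = a0 + of_int k"
  define b where "b = b0 + of_int l"
  have ab: "self_contact_couple \<gamma> a b"
    using a0(2) contact_shift contact_sym unfolding a_def b_def by blast
  have gab: "\<gamma> a = y" "\<gamma> b = y" using a0 \<open>\<gamma> b0 = y\<close> by (auto simp: a_def b_def curve_int)
  have ne: "a \<noteq> q" "b \<noteq> q" "a \<noteq> b" using gab gq \<open>x \<noteq> y\<close> ab by (auto simp: self_contact_couple_def)
  have "self_contact_couple \<gamma> (min a b) (max a b)" "min a b < max a b"
    using ab contact_sym[OF ab] ne by (auto simp: min_def max_def)
  then have "\<exists>r s. p < r \<and> r < s \<and> s < p + 1 \<and> self_contact_couple \<gamma> r s \<and> r \<noteq> q \<and> s \<noteq> q"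
    using k l ne by (intro exI[of _ "min a b"] exI[of _ "max a b"]) (auto simp: min_def max_def a_def b_def)
  then obtain r s where rs: "p < r" "r < s" "s < p + 1" "self_contact_couple \<gamma> r s" "r \<noteq> q" "s \<noteq> q"
    by blast
  have qp: "self_contact_couple \<gamma> q (p + 1)"
    using contact_shift[of q p 1] contact_sym[OF q(3)] by simp
  consider "q < r" | "s < q" | "r < q" "q < s" using rs by linarith
  then show thesis
  proof cases
    case 1
    then show thesis using that[of p q r s] q rs by simp
  next
    case 2
    then show thesis using that[of r s q "p + 1"] q rs qp by simp
  next
    case 3
    then show thesis using contact_no_crossing[of p r q s] q rs by simp
  qed
qed

lemma frac_unique_int:
  fixes r u :: real
  assumes "r \<in> {0..<1}" "r - u \<in> \<int>"
  shows "r = frac u"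
proof -
  have "frac u = r" using assms by (simp add: frac_unique_iff) (metis Ints_minus minus_diff_eq)
  then show ?thesis by simp
qed

lemma times_at_contact:
  assumes "x \<in> \<gamma> ` contact_set \<gamma>"
  shows "finite (times_at \<gamma> x) \<and> card (times_at \<gamma> x) \<le> 2"
proof -
  obtain t s where ts: "\<gamma> t = x" "self_contact_couple \<gamma> t s" using assms by (auto simp: contact_set_def)
  have "times_at \<gamma> x \<subseteq> {frac t, frac s}"
  proof
    fix r assume "r \<in> times_at \<gamma> x"
    then have r: "r \<in> {0..<1}" "\<gamma> r = x" by (auto simp: times_at_def)
    show "r \<in> {frac t, frac s}"
    proof (cases "r - t \<in> \<int>")
      case True
      then show ?thesis using frac_unique_int r by blast
    next
      case False
      then have "self_contact_couple \<gamma> t r"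
        using contact_sym[of r t] r ts by (simp add: self_contact_couple_def)
      from contact_unique[OF this ts(2)] show ?thesis using frac_unique_int r by blast
    qed
  qed
  moreover have "card {frac t, frac s} \<le> 2" by (simp add: card_insert_if)
  ultimately show ?thesis by (meson card_mono finite.emptyI finite_insert finite_subset le_trans)
qed

lemma contact_partner:
  assumes "t \<in> contact_set \<gamma>"
  shows "\<exists>!s. s \<in> {0..<1} \<and> self_contact_couple \<gamma> t s"
proof -
  obtain s where s: "self_contact_couple \<gamma> t s" using assms by (auto simp: contact_set_def)
  show ?thesis
  proof (rule ex1I[of _ "frac s"])
    show "frac s \<in> {0..<1} \<and> self_contact_couple \<gamma> t (frac s)"
      using s contact_shift[of t s "- \<lfloor>s\<rfloor>"] by (simp add: frac_def frac_lt_1[unfolded frac_def])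
    fix r assume r: "r \<in> {0..<1} \<and> self_contact_couple \<gamma> t r"
    then show "r = frac s" using contact_unique[of t r s] s frac_unique_int by blast
  qed
qed

end

section \<open>Structure of minimisers\<close>

theorem theorem4p2:
  fixes \<Omega> :: "(real ^ 2) set" and \<gamma> :: "real \<Rightarrow> real ^ 2"
  assumes "open \<Omega>" and "bounded \<Omega>" and "lipschitz_boundary \<Omega>"
    and "minimal_curve \<Omega> \<gamma>" and "constant_speed \<gamma>"
  shows "(\<forall>x \<in> \<gamma> ` contact_set \<gamma>. finite (times_at \<gamma> x) \<and> card (times_at \<gamma> x) \<le> 2) \<and>
    (\<forall>t \<in> contact_set \<gamma>. \<exists>!s. s \<in> {0..<1} \<and> self_contact_couple \<gamma> t s) \<and>
    ((\<exists>x \<in> \<gamma> ` contact_set \<gamma>. \<exists>y \<in> \<gamma> ` contact_set \<gamma>. x \<noteq> y) \<longrightarrow>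
      (\<exists>t s \<tau> \<sigma>. t < s \<and> s < \<tau> \<and> \<tau> < \<sigma> \<and> \<sigma> < t + 1 \<and>
        self_contact_couple \<gamma> t s \<and> self_contact_couple \<gamma> \<tau> \<sigma> \<and>
        {t<..<s} \<inter> contact_set \<gamma> = {} \<and> {\<tau><..<\<sigma>} \<inter> contact_set \<gamma> = {} \<and>
        inj_on \<gamma> {s<..<\<tau>} \<and> inj_on \<gamma> {\<sigma><..<t + 1} \<and>
        arc_energy \<gamma> s \<tau> = arc_energy \<gamma> \<sigma> (t + 1) \<and>
        (\<forall>a \<in> {s<..<\<tau>}. \<forall>b \<in> {\<sigma><..<t + 1}. \<gamma> a = \<gamma> b \<longrightarrow>
          (\<exists>c. velocity \<gamma> a = c *\<^sub>R velocity \<gamma> b) \<and>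
          arc_energy \<gamma> s a = arc_energy \<gamma> b (t + 1) \<and>
          arc_energy \<gamma> a \<tau> = arc_energy \<gamma> \<sigma> b)))"
proof -
  obtain c where "\<And>t. norm (velocity \<gamma> t) = c" using assms(5) unfolding constant_speed_def by blast
  then interpret constant_speed_minimiser \<Omega> \<gamma> c using assms(4) by unfold_locales
  show ?thesis
  proof (intro conjI ballI impI)
    assume "\<exists>x \<in> \<gamma> ` contact_set \<gamma>. \<exists>y \<in> \<gamma> ` contact_set \<gamma>. x \<noteq> y"
    then obtain x y where "x \<in> \<gamma> ` contact_set \<gamma>" "y \<in> \<gamma> ` contact_set \<gamma>" "x \<noteq> y" by blast
    then obtain p q p' q' where pq: "p < q" "q < p'" "p' < q'" "q' < p + 1"
      "self_contact_couple \<gamma> p q" "self_contact_couple \<gamma> p' q'" by (rule disjoint_contacts)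
    obtain t s where ts: "p \<le> t" "t < s" "s \<le> q" "self_contact_couple \<gamma> t s"
      "{t<..<s} \<inter> contact_set \<gamma> = {}" using innermost_contact[of p q] pq by auto
    obtain \<tau> \<sigma> where \<tau>\<sigma>: "p' \<le> \<tau>" "\<tau> < \<sigma>" "\<sigma> \<le> q'" "self_contact_couple \<gamma> \<tau> \<sigma>"
      "{\<tau><..<\<sigma>} \<inter> contact_set \<gamma> = {}" using innermost_contact[of p' q'] pq by auto
    have ord: "t < s" "s < \<tau>" "\<tau> < \<sigma>" "\<sigma> < t + 1" using pq ts \<tau>\<sigma> by linarith+
    note shifted = contact_next_turn[OF ts(4)]
    have inj: "inj_on \<gamma> {\<sigma><..<t + 1}"
      by (rule no_contact_between_contacts[OF _ _ _ _ \<tau>\<sigma>(4) shifted]) (use ord in auto)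
    have mutual: "(\<exists>c. velocity \<gamma> a = c *\<^sub>R velocity \<gamma> b) \<and>
          arc_energy \<gamma> s a = arc_energy \<gamma> b (t + 1) \<and> arc_energy \<gamma> a \<tau> = arc_energy \<gamma> \<sigma> b"
      if "a \<in> {s<..<\<tau>}" "b \<in> {\<sigma><..<t + 1}" "\<gamma> a = \<gamma> b" for a b
    proof -
      have ab: "s < a" "a < \<tau>" "\<sigma> < b" "b < t + 1" using that by auto
      have con: "self_contact_couple \<gamma> a b"
        using not_int_near[of a b] that(3) ab ord by (simp add: self_contact_couple_def)
      have "velocity \<gamma> a = (-1) *\<^sub>R velocity \<gamma> b" using contact_opposite[OF con] by simp
      moreover have "arc_energy \<gamma> s a = arc_energy \<gamma> b (t + 1)"
        by (rule energy_between_contacts[OF _ _ _ _ ts(4) con]) (use ab ord in auto)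
      moreover have "arc_energy \<gamma> a \<tau> = arc_energy \<gamma> \<sigma> b"
      proof -
        \<comment> \<open>The couples \<open>(\<tau>, \<sigma>)\<close> and \<open>(b, a + 1)\<close>: the circle is read from \<open>\<tau>\<close> on.\<close>
        have ba: "self_contact_couple \<gamma> b (a + 1)" using contact_sym[OF con] contact_shift[of b a 1] by simp
        have "arc_energy \<gamma> \<sigma> b = arc_energy \<gamma> (a + 1) (\<tau> + 1)"
          by (rule energy_between_contacts[OF _ _ _ _ \<tau>\<sigma>(4) ba]) (use ab ord in auto)
        then show ?thesis using energy_shift[of a 1 \<tau>] by simp
      qed
      ultimately show ?thesis by blast
    qed
    show "\<exists>t s \<tau> \<sigma>. t < s \<and> s < \<tau> \<and> \<tau> < \<sigma> \<and> \<sigma> < t + 1 \<and>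
        self_contact_couple \<gamma> t s \<and> self_contact_couple \<gamma> \<tau> \<sigma> \<and>
        {t<..<s} \<inter> contact_set \<gamma> = {} \<and> {\<tau><..<\<sigma>} \<inter> contact_set \<gamma> = {} \<and>
        inj_on \<gamma> {s<..<\<tau>} \<and> inj_on \<gamma> {\<sigma><..<t + 1} \<and>
        arc_energy \<gamma> s \<tau> = arc_energy \<gamma> \<sigma> (t + 1) \<and>
        (\<forall>a \<in> {s<..<\<tau>}. \<forall>b \<in> {\<sigma><..<t + 1}. \<gamma> a = \<gamma> b \<longrightarrow>
          (\<exists>c. velocity \<gamma> a = c *\<^sub>R velocity \<gamma> b) \<and>
          arc_energy \<gamma> s a = arc_energy \<gamma> b (t + 1) \<and>
          arc_energy \<gamma> a \<tau> = arc_energy \<gamma> \<sigma> b)"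
      by (intro exI[of _ t] exI[of _ s] exI[of _ \<tau>] exI[of _ \<sigma>] conjI)
         ((fact ord ts(4,5) \<tau>\<sigma>(4,5) inj no_contact_between_contacts[OF ord ts(4) \<tau>\<sigma>(4)]
            energy_between_contacts[OF ord ts(4) \<tau>\<sigma>(4)])+, use mutual in blast)
  qed (use times_at_contact contact_partner in auto)
qed

end
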